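(* Let $(\mathbf{X},\mathbf{Y},\mathbf{Z})$ be jointly distributed random vectors with values in $\mathbb{R}^{d_x}\times\mathbb{R}^{d_y}\times\mathbb{R}^{d_z}$. Suppose there exist two maps $\mathbf{f}:\mathbb{R}^{d_x}\times\mathbb{R}^{d_z}\to\mathbb{R}^{d_x}$ and $\mathbf{g}:\mathbb{R}^{d_y}\times\mathbb{R}^{d_z}\to\mathbb{R}^{d_y}$, each invertible with respect to its first argument, such that, setting $\boldsymbol{\xi}=\mathbf{f}(\mathbf{X},\mathbf{Z})$ and $\boldsymbol{\eta}=\mathbf{g}(\mathbf{Y},\mathbf{Z})$, for every $\mathbf{z}\in\operatorname{supp}(\mathbf{Z})$ the conditional distribution of $\mathbf{f}(\mathbf{X},\mathbf{Z})$ given $\mathbf{Z}=\mathbf{z}$ equals the (unconditional) distribution of $\boldsymbol{\xi}$, and the conditional distribution of $\mathbf{g}(\mathbf{Y},\mathbf{Z})$ given $\mathbf{Z}=\mathbf{z}$ equals the (unconditional) distribution of $\boldsymbol{\eta}$. Then $\boldsymbol{\xi}$ is independent of $\mathbf{Z}$ and $\boldsymbol{\eta}$ is independent of $\mathbf{Z}$. Furthermore, the following three statements are equivalent: (i) $\mathbf{X}$ and $\mathbf{Y}$ are conditionally independent given $\mathbf{Z}$; (ii) $\boldsymbol{\eta}$ is independent of $(\boldsymbol{\xi},\mathbf{Z})$; (iii) $\boldsymbol{\xi}$ is independent of $(\boldsymbol{\eta},\mathbf{Z})$.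
   Context: A function $f:\mathbb{R}^{d}\times\mathbb{R}^{d_z}\to\mathbb{R}^{d}$ is called invertible with respect to its first argument if there exists a function $f^{-1}:\mathbb{R}^{d}\times\mathbb{R}^{d_z}\to\mathbb{R}^{d}$ such that $f^{-1}(f(\mathbf{x},\mathbf{z}),\mathbf{z})=f(f^{-1}(\mathbf{x},\mathbf{z}),\mathbf{z})=\mathbf{x}$ for all $\mathbf{x}\in\mathbb{R}^{d}$ and $\mathbf{z}\in\mathbb{R}^{d_z}$. As transport maps, $\mathbf{f},\mathbf{g}$ and these inverses are understood to be Borel measurable. $\operatorname{supp}(\mathbf{Z})$ denotes the support of the random vector $\mathbf{Z}$. *)

theory Defs
  imports "HOL-Probability.Probability"
begin

definition borel_invertible_fst ::
    "('a::topological_space \<times> 'c::topological_space \<Rightarrow> 'a) \<Rightarrow> bool" where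
  "borel_invertible_fst f \<longleftrightarrow> f \<in> borel_measurable borel \<and>
     (\<exists>finv \<in> borel_measurable borel.
        \<forall>x z. finv (f (x, z), z) = x \<and> f (finv (x, z), z) = x)"

definition rv_support :: "'w measure \<Rightarrow> ('w \<Rightarrow> 'c::topological_space) \<Rightarrow> 'c set" where
  "rv_support M Z = {z. \<forall>U. open U \<and> z \<in> U \<longrightarrow> emeasure (distr M borel Z) U > 0}"

text \<open>
  The kernel \<open>\<kappa>\<close> is a version of the conditional distribution of \<open>V\<close> given \<open>Z\<close>; the measure
  \<open>\<kappa> z\<close> is the conditional distribution of \<open>V\<close> given \<open>Z = z\<close>. Versions are unique only up to
  null sets of the law of \<open>Z\<close>.
\<close>

definition cond_distr ::
    "'w measure \<Rightarrow> ('w \<Rightarrow> 'a::topological_space) \<Rightarrow> ('w \<Rightarrow> 'c::topological_space)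
       \<Rightarrow> ('c \<Rightarrow> 'a measure) \<Rightarrow> bool" where
  "cond_distr M V Z \<kappa> \<longleftrightarrow> \<kappa> \<in> borel \<rightarrow>\<^sub>M prob_algebra borel \<and>
     (\<forall>A \<in> sets borel. \<forall>B \<in> sets borel.
        emeasure M {\<omega> \<in> space M. V \<omega> \<in> A \<and> Z \<omega> \<in> B} =
        (\<integral>\<^sup>+ z \<in> B. emeasure (\<kappa> z) A \<partial>distr M borel Z))"

text \<open>
  The library's \<open>indep_var\<close> forces both variables to have the same value type; the following is the same
  notion for variables of different types, see \<open>indep_rv_iff_indep_var\<close>.
\<close>

definition indep_rv ::
    "'w measure \<Rightarrow> ('w \<Rightarrow> 'a::topological_space) \<Rightarrow> ('w \<Rightarrow> 'b::topological_space) \<Rightarrow> bool" where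
  "indep_rv M X Y \<longleftrightarrow> prob_space.indep_set M
     (sets (vimage_algebra (space M) X borel)) (sets (vimage_algebra (space M) Y borel))"

lemma (in prob_space) indep_rv_iff_indep_var:
  assumes "X \<in> borel_measurable M" and "Y \<in> borel_measurable M"
  shows "indep_rv M X Y \<longleftrightarrow> indep_var borel X borel Y"
  using assms unfolding indep_rv_def indep_var_eq
  by (simp add: sets_vimage_algebra)

definition cond_indep_var ::
    "'w measure \<Rightarrow> ('w \<Rightarrow> 'a::topological_space) \<Rightarrow> ('w \<Rightarrow> 'b::topological_space)
       \<Rightarrow> ('w \<Rightarrow> 'c::topological_space) \<Rightarrow> bool" where
  "cond_indep_var M X Y Z \<longleftrightarrow>
     (let F = vimage_algebra (space M) Z borel in
      \<forall>A \<in> sets borel. \<forall>B \<in> sets borel. AE \<omega> in M.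
        real_cond_exp M F (\<lambda>\<omega>. indicator A (X \<omega>) * indicator B (Y \<omega>)) \<omega> =
        real_cond_exp M F (\<lambda>\<omega>. indicator A (X \<omega>)) \<omega> *
        real_cond_exp M F (\<lambda>\<omega>. indicator B (Y \<omega>)) \<omega>)"

end

theory Submission
  imports Defs
begin

text \<open>
  Since the law of \<open>Z\<close> is carried by its support, constancy of the conditional law there gives
  independence of \<open>Z\<close>. Conditional independence of \<open>X\<close> and \<open>Y\<close> given \<open>Z\<close> means that
  \<open>E[1\<^sub>D(X, Z) 1\<^sub>B(Y)] = E[1\<^sub>D(X, Z) P(Y \<in> B | Z)]\<close> for all rectangles \<open>D\<close>, hence for all Borel
  sets \<open>D\<close>; so \<open>X\<close> may be replaced by \<open>f(X, Z)\<close> and, by symmetry, \<open>Y\<close> by \<open>g(Y, Z)\<close>, and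
  invertibility allows to go back. Once \<open>\<eta>\<close> is independent of \<open>Z\<close>, \<open>P(\<eta> \<in> B | Z)\<close> is the constant
  \<open>P(\<eta> \<in> B)\<close>, and the criterion says that \<open>\<eta>\<close> is independent of \<open>(\<xi>, Z)\<close>.
\<close>

section \<open>Extension of integral identities from rectangles to Borel sets of pairs\<close>

text \<open>Rectangles form an intersection-stable generator of the Borel sets of the product, and
  for integrable \<open>u\<close> and \<open>v\<close> both sides are finite signed measures in
  \<open>D\<close>. The sets on which they agree therefore form a Dynkin system, and the induction
  over disjoint unions applies. The weights may change sign, so the closure properties are checked
  on integrals.\<close>

lemma integral_indicator_pair_eqI:
  fixes U :: "'w \<Rightarrow> 'a::second_countable_topology" and W :: "'w \<Rightarrow> 'b::second_countable_topology"
    and u v :: "'w \<Rightarrow> real"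
  assumes [measurable]: "U \<in> borel_measurable M" "W \<in> borel_measurable M"
    and u: "integrable M u" and v: "integrable M v"
    and rect: "\<And>A C. A \<in> sets borel \<Longrightarrow> C \<in> sets borel \<Longrightarrow>
      (\<integral>\<omega>. indicator A (U \<omega>) * indicator C (W \<omega>) * u \<omega> \<partial>M) =
      (\<integral>\<omega>. indicator A (U \<omega>) * indicator C (W \<omega>) * v \<omega> \<partial>M)"
    and "D \<in> sets borel"
  shows "(\<integral>\<omega>. indicator D (U \<omega>, W \<omega>) * u \<omega> \<partial>M) = (\<integral>\<omega>. indicator D (U \<omega>, W \<omega>) * v \<omega> \<partial>M)"
proof -
  let ?G = "{A \<times> C | A C. A \<in> sets (borel :: 'a measure) \<and> C \<in> sets (borel :: 'b measure)}"
  let ?I = "\<lambda>D w. \<integral>\<omega>. indicator D (U \<omega>, W \<omega>) * w \<omega> \<partial>M"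
  \<comment> \<open>Second countability enters here: through \<open>borel_prod\<close> the Borel
    sets of the product are those of the product sigma-algebra.\<close>
  have sets_eq: "sigma_sets UNIV ?G = sets (borel :: ('a \<times> 'b) measure)"
    unfolding borel_prod[symmetric] sets_pair_measure by simp
  have sets_M: "(\<lambda>\<omega>. (U \<omega>, W \<omega>)) -` D \<inter> space M \<in> sets M" if "D \<in> sets borel" for D
  proof -
    have "(\<lambda>\<omega>. (U \<omega>, W \<omega>)) \<in> borel_measurable M"
      by simp
    then show ?thesis
      using that by (rule measurable_sets)
  qed
  have set_int: "?I D w = (LINT \<omega>:((\<lambda>\<omega>. (U \<omega>, W \<omega>)) -` D \<inter> space M)|M. w \<omega>)" for D and w :: "'w \<Rightarrow> real"
    unfolding set_lebesgue_integral_def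
    by (rule Bochner_Integration.integral_cong) (auto simp: indicator_def)
  have int: "integrable M (\<lambda>\<omega>. indicator D (U \<omega>, W \<omega>) * w \<omega>)"
    if "D \<in> sets borel" "integrable M w" for D and w :: "'w \<Rightarrow> real"
  proof -
    have "integrable M (\<lambda>\<omega>. indicator ((\<lambda>\<omega>. (U \<omega>, W \<omega>)) -` D \<inter> space M) \<omega> * w \<omega>)"
      using integrable_mult_indicator[OF sets_M[OF that(1)] that(2)] by simp
    then show ?thesis
      by (rule Bochner_Integration.integrable_cong[THEN iffD1, rotated 2]) (auto simp: indicator_def)
  qed
  have rect': "?I (A \<times> C) u = ?I (A \<times> C) v" if "A \<in> sets borel" "C \<in> sets borel" for A C
    using rect[OF that] by (simp add: indicator_times)
  have "Int_stable ?G"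
    by (rule Int_stable_pair_measure_generator)
  moreover have "?G \<subseteq> Pow UNIV"
    by simp
  moreover have "D \<in> sigma_sets UNIV ?G"
    unfolding sets_eq by fact
  ultimately show ?thesis
  proof (induction rule: sigma_sets_induct_disjoint)
    case (basic D)
    then show ?case
      using rect' by auto
  next
    case empty
    show ?case
      by simp
  next
    case (compl D)
    then have D: "D \<in> sets borel"
      unfolding sets_eq by simp
    have "?I (UNIV - D) w = integral\<^sup>L M w - ?I D w" if "integrable M w" for w :: "'w \<Rightarrow> real"
    proof -
      have "?I (UNIV - D) w = (\<integral>\<omega>. w \<omega> - indicator D (U \<omega>, W \<omega>) * w \<omega> \<partial>M)"
        by (rule Bochner_Integration.integral_cong) (auto simp: indicator_def)
      then show ?thesis
        using that int[OF D that] by simp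
    qed
    \<comment> \<open>The total masses agree because the whole space is itself a rectangle.\<close>
    moreover have "integral\<^sup>L M u = integral\<^sup>L M v"
      using rect[of UNIV UNIV] by simp
    ultimately show ?case
      using compl u v by simp
  next
    case (union D)
    then have D: "D i \<in> sets borel" for i
      unfolding sets_eq by auto
    have "?I (\<Union>i. D i) w = (\<Sum>i. ?I (D i) w)" if w: "integrable M w" for w :: "'w \<Rightarrow> real"
    proof -
      let ?E = "\<lambda>i. (\<lambda>\<omega>. (U \<omega>, W \<omega>)) -` D i \<inter> space M"
      have sets_E: "?E i \<in> sets M" for i
        using sets_M[OF D] .
      have "set_integrable M (\<Union>i. ?E i) w"
        unfolding set_integrable_def
        by (intro integrable_mult_indicator w sets.countable_UN'' sets_E countableI_type)
      moreover have "?E i \<inter> ?E j = {}" if "i \<noteq> j" for i j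
        using union(1) that by (auto simp: disjoint_family_on_def)
      ultimately have "(LINT \<omega>:(\<Union>i. ?E i)|M. w \<omega>) = (\<Sum>i. LINT \<omega>:?E i|M. w \<omega>)"
        using sets_E by (intro lebesgue_integral_countable_add) auto
      moreover have "(\<Union>i. ?E i) = (\<lambda>\<omega>. (U \<omega>, W \<omega>)) -` (\<Union>i. D i) \<inter> space M"
        by auto
      ultimately show ?thesis
        unfolding set_int by simp
    qed
    then show ?case
      using union u v by simp
  qed
qed

section \<open>Independence and conditional independence as integral identities\<close>

context prob_space
begin

lemma integrable_indicator_comp:
  fixes X :: "'a \<Rightarrow> 'b::topological_space"
  assumes "X \<in> borel_measurable M" "A \<in> sets borel"
  shows "integrable M (\<lambda>\<omega>. indicator A (X \<omega>) :: real)"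
  using assms by (intro integrable_const_bound[where B = 1]) (auto simp: indicator_def)

lemma integral_indicator_comp:
  fixes X :: "'a \<Rightarrow> 'b::topological_space"
  assumes "X \<in> borel_measurable M" "A \<in> sets borel"
  shows "(\<integral>\<omega>. indicator A (X \<omega>) \<partial>M) = prob (X -` A \<inter> space M)"
proof -
  have "(\<integral>\<omega>. indicator A (X \<omega>) \<partial>M) = (\<integral>\<omega>. indicator (X -` A \<inter> space M) \<omega> \<partial>M :: real)"
    by (rule Bochner_Integration.integral_cong) (auto simp: indicator_def)
  then show ?thesis
    by simp
qed

lemma indep_rv_iff_integral:
  fixes X :: "'a \<Rightarrow> 'b::topological_space" and Y :: "'a \<Rightarrow> 'c::topological_space"
  assumes X: "X \<in> borel_measurable M" and Y: "Y \<in> borel_measurable M"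
  shows "indep_rv M X Y \<longleftrightarrow> (\<forall>A \<in> sets borel. \<forall>B \<in> sets borel.
    (\<integral>\<omega>. indicator B (Y \<omega>) * indicator A (X \<omega>) \<partial>M) =
    (\<integral>\<omega>. indicator B (Y \<omega>) * prob (X -` A \<inter> space M) \<partial>M))"
proof -
  let ?E = "\<lambda>A. X -` A \<inter> space M" and ?G = "\<lambda>B. Y -` B \<inter> space M"
  have joint: "(\<integral>\<omega>. indicator B (Y \<omega>) * indicator A (X \<omega>) \<partial>M) = prob (?E A \<inter> ?G B)" for A B
  proof -
    have "(\<integral>\<omega>. indicator B (Y \<omega>) * indicator A (X \<omega>) \<partial>M) = (\<integral>\<omega>. indicator (?E A \<inter> ?G B) \<omega> \<partial>M :: real)"
      by (rule Bochner_Integration.integral_cong) (auto simp: indicator_def)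
    then show ?thesis
      by (simp add: Int_ac)
  qed
  have prod: "(\<integral>\<omega>. indicator B (Y \<omega>) * prob (?E A) \<partial>M) = prob (?E A) * prob (?G B)"
    if "B \<in> sets borel" for A B
    using integral_indicator_comp[OF Y that] by simp
  have sets_eq: "sets (vimage_algebra (space M) X borel) = ?E ` sets borel"
    "sets (vimage_algebra (space M) Y borel) = ?G ` sets borel"
    by (simp_all add: sets_vimage_algebra2 setcompr_eq_image)
  moreover have "?E ` sets borel \<subseteq> events" "?G ` sets borel \<subseteq> events"
    using X Y by (auto intro: measurable_sets)
  ultimately have "indep_rv M X Y \<longleftrightarrow>
      (\<forall>A \<in> sets borel. \<forall>B \<in> sets borel. prob (?E A \<inter> ?G B) = prob (?E A) * prob (?G B))"
    unfolding indep_rv_def indep_sets2_eq sets_eq by simp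
  \<comment> \<open>The deleted simp rules would pull the constant out of the integral before
    \<open>prod\<close> could match.\<close>
  then show ?thesis
    unfolding joint by (simp add: prod del: integral_mult_left_zero integral_mult_right_zero)
qed

lemma subalgebra_vimage_algebra:
  assumes "Z \<in> borel_measurable M"
  shows "subalgebra M (vimage_algebra (space M) Z borel)"
  using assms by (auto simp: subalgebra_def sets_vimage_algebra2 intro: measurable_sets)

lemma sigma_finite_subalgebra_vimage_algebra:
  assumes "Z \<in> borel_measurable M"
  shows "sigma_finite_subalgebra M (vimage_algebra (space M) Z borel)"
  by (rule finite_measure_subalgebra_is_sigma_finite)
    (simp add: finite_measure_subalgebra_def finite_measure_subalgebra_axioms_def
      finite_measure_axioms subalgebra_vimage_algebra[OF assms])

text \<open>An almost sure identity between \<open>F\<close>-measurable integrable functions can be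
  tested by integrating over the events \<open>Z \<in> C\<close>. The left side then gives the joint
  integral; on the right, \<open>1_C(Z) P(Y \<in> B | Z)\<close> is \<open>F\<close>-measurable, so
  \<open>P(X \<in> A | Z)\<close> may be replaced by the indicator of \<open>X \<in> A\<close>. The
  resulting criterion involves \<open>X\<close> only through \<open>1_A(X) 1_C(Z)\<close>, which is
  what allows passing to arbitrary Borel sets of pairs.\<close>

lemma cond_indep_var_iff_integral:
  fixes X :: "'a \<Rightarrow> 'b::topological_space" and Y :: "'a \<Rightarrow> 'c::topological_space"
    and Z :: "'a \<Rightarrow> 'd::topological_space"
  defines "F \<equiv> vimage_algebra (space M) Z borel"
  assumes X [measurable]: "X \<in> borel_measurable M" and Y [measurable]: "Y \<in> borel_measurable M"
    and Z [measurable]: "Z \<in> borel_measurable M"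
  shows "cond_indep_var M X Y Z \<longleftrightarrow>
    (\<forall>A \<in> sets borel. \<forall>B \<in> sets borel. \<forall>C \<in> sets borel.
      (\<integral>\<omega>. indicator A (X \<omega>) * indicator C (Z \<omega>) * indicator B (Y \<omega>) \<partial>M) =
      (\<integral>\<omega>. indicator A (X \<omega>) * indicator C (Z \<omega>) *
         real_cond_exp M F (\<lambda>\<omega>. indicator B (Y \<omega>)) \<omega> \<partial>M))"
proof -
  interpret F: sigma_finite_subalgebra M F
    unfolding F_def by (rule sigma_finite_subalgebra_vimage_algebra[OF Z])
  have Z_F [measurable]: "Z \<in> borel_measurable F"
    unfolding F_def by (rule measurable_vimage_algebra1) simp
  let ?p = "\<lambda>A. real_cond_exp M F (\<lambda>\<omega>. indicator A (X \<omega>))"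
  let ?q = "\<lambda>B. real_cond_exp M F (\<lambda>\<omega>. indicator B (Y \<omega>))"
  let ?r = "\<lambda>A B. real_cond_exp M F (\<lambda>\<omega>. indicator A (X \<omega>) * indicator B (Y \<omega>))"
  have AE_eq_iff: "(AE \<omega> in M. ?r A B \<omega> = ?p A \<omega> * ?q B \<omega>) \<longleftrightarrow>
      (\<forall>C \<in> sets borel. (\<integral>\<omega>. indicator A (X \<omega>) * indicator C (Z \<omega>) * indicator B (Y \<omega>) \<partial>M) =
        (\<integral>\<omega>. indicator A (X \<omega>) * indicator C (Z \<omega>) * ?q B \<omega> \<partial>M))"
    if A [measurable]: "A \<in> sets borel" and B [measurable]: "B \<in> sets borel" for A B
  proof -
    have int_AB: "integrable M (\<lambda>\<omega>. indicator A (X \<omega>) * indicator B (Y \<omega>) :: real)"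
      by (rule integrable_const_bound[where B = 1]) (auto simp: indicator_def)
    \<comment> \<open>This bound makes the products containing \<open>?q B\<close>
      integrable.\<close>
    have bound_q: "AE \<omega> in M. norm (?q B \<omega>) \<le> 1"
    proof -
      have int_B: "integrable M (\<lambda>\<omega>. indicator B (Y \<omega>) :: real)"
        by (rule integrable_indicator_comp[OF Y B])
      have "AE \<omega> in M. ?q B \<omega> \<ge> 0"
        by (rule F.real_cond_exp_ge_c[OF int_B]) auto
      moreover have "AE \<omega> in M. ?q B \<omega> \<le> 1"
        by (rule F.real_cond_exp_le_c[OF int_B]) (auto simp: indicator_def)
      ultimately show ?thesis
        by eventually_elim simp
    qed
    have int_Cq: "integrable M (\<lambda>\<omega>. indicator A (X \<omega>) * (indicator C (Z \<omega>) * ?q B \<omega>))"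
      if [measurable]: "C \<in> sets borel" for C
      using bound_q by (intro integrable_const_bound[where B = 1]) (auto simp: indicator_def)
    \<comment> \<open>The defining property of \<open>?p A\<close> is used with the
      \<open>F\<close>-measurable weight \<open>1_C(Z) * ?q B\<close>.\<close>
    have pull_out: "integrable M (\<lambda>\<omega>. indicator C (Z \<omega>) * ?q B \<omega> * ?p A \<omega>)"
      "(\<integral>\<omega>. indicator C (Z \<omega>) * (?p A \<omega> * ?q B \<omega>) \<partial>M) =
       (\<integral>\<omega>. indicator A (X \<omega>) * indicator C (Z \<omega>) * ?q B \<omega> \<partial>M)"
      if [measurable]: "C \<in> sets borel" for C
    proof -
      have "integrable M (\<lambda>\<omega>. indicator C (Z \<omega>) * ?q B \<omega> * indicator A (X \<omega>))"
        using int_Cq[OF that] by (simp add: mult_ac)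
      note * = F.real_cond_exp_intg[OF this]
      from * show "integrable M (\<lambda>\<omega>. indicator C (Z \<omega>) * ?q B \<omega> * ?p A \<omega>)"
        by simp
      from * show "(\<integral>\<omega>. indicator C (Z \<omega>) * (?p A \<omega> * ?q B \<omega>) \<partial>M) =
          (\<integral>\<omega>. indicator A (X \<omega>) * indicator C (Z \<omega>) * ?q B \<omega> \<partial>M)"
        by (simp add: mult_ac)
    qed
    have set_int: "(LINT \<omega>:(Z -` C \<inter> space M)|M. h \<omega>) = (\<integral>\<omega>. indicator C (Z \<omega>) * h \<omega> \<partial>M)"
      for C and h :: "'a \<Rightarrow> real"
      unfolding set_lebesgue_integral_def
      by (rule Bochner_Integration.integral_cong) (auto simp: indicator_def)
    show ?thesis
    proof (intro iffI ballI)
      fix C :: "'d set"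
      assume AE: "AE \<omega> in M. ?r A B \<omega> = ?p A \<omega> * ?q B \<omega>" and C [measurable]: "C \<in> sets borel"
      have "integrable M (\<lambda>\<omega>. indicator C (Z \<omega>) * (indicator A (X \<omega>) * indicator B (Y \<omega>)) :: real)"
        by (rule integrable_const_bound[where B = 1]) (auto simp: indicator_def)
      from F.real_cond_exp_intg(2)[OF this]
      have "(\<integral>\<omega>. indicator C (Z \<omega>) * ?r A B \<omega> \<partial>M) =
          (\<integral>\<omega>. indicator C (Z \<omega>) * (indicator A (X \<omega>) * indicator B (Y \<omega>)) \<partial>M)"
        by simp
      moreover have "(\<integral>\<omega>. indicator C (Z \<omega>) * ?r A B \<omega> \<partial>M) =
          (\<integral>\<omega>. indicator C (Z \<omega>) * (?p A \<omega> * ?q B \<omega>) \<partial>M)"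
        using AE by (intro integral_cong_AE) auto
      ultimately show "(\<integral>\<omega>. indicator A (X \<omega>) * indicator C (Z \<omega>) * indicator B (Y \<omega>) \<partial>M) =
          (\<integral>\<omega>. indicator A (X \<omega>) * indicator C (Z \<omega>) * ?q B \<omega> \<partial>M)"
        using pull_out(2)[OF C] by (simp add: mult_ac)
    next
      assume eq: "\<forall>C \<in> sets borel.
        (\<integral>\<omega>. indicator A (X \<omega>) * indicator C (Z \<omega>) * indicator B (Y \<omega>) \<partial>M) =
        (\<integral>\<omega>. indicator A (X \<omega>) * indicator C (Z \<omega>) * ?q B \<omega> \<partial>M)"
      show "AE \<omega> in M. ?r A B \<omega> = ?p A \<omega> * ?q B \<omega>"
      \<comment> \<open>Uniqueness of conditional expectation: \<open>?p A * ?q B\<close> has the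
        right integral over every event of \<open>F\<close>, and each such event has the form
        \<open>Z \<in> C\<close>.\<close>
      proof (rule F.real_cond_exp_charact[OF _ int_AB])
        fix E assume "E \<in> sets F"
        then obtain C where C: "C \<in> sets borel" and E: "E = Z -` C \<inter> space M"
          unfolding F_def by (auto simp: sets_vimage_algebra2)
        show "(LINT \<omega>:E|M. indicator A (X \<omega>) * indicator B (Y \<omega>)) = (LINT \<omega>:E|M. ?p A \<omega> * ?q B \<omega>)"
          unfolding E set_int pull_out(2)[OF C] using eq C by (simp add: mult_ac)
      next
        show "integrable M (\<lambda>\<omega>. ?p A \<omega> * ?q B \<omega>)"
          using pull_out(1)[of UNIV] by (simp add: mult_ac)
      qed simp
    qed
  qed
  show ?thesis
    unfolding cond_indep_var_def F_def[symmetric] Let_def by (auto simp: AE_eq_iff)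
qed

lemma cond_indep_var_sym: "cond_indep_var M X Y Z \<Longrightarrow> cond_indep_var M Y X Z"
  unfolding cond_indep_var_def Let_def by (simp add: mult.commute)

lemma cond_indep_var_commute: "cond_indep_var M X Y Z \<longleftrightarrow> cond_indep_var M Y X Z"
  by (blast intro: cond_indep_var_sym)

section \<open>Change of variables under conditional independence\<close>

text \<open>An event on \<open>h (X, Z)\<close> and \<open>Z\<close> is an event on the pair
  \<open>(X, Z)\<close>, and the integral criterion for \<open>X\<close> extends from rectangles to
  all Borel events of that pair.\<close>

lemma cond_indep_var_transform_fst:
  fixes X :: "'a \<Rightarrow> 'b::second_countable_topology" and Y :: "'a \<Rightarrow> 'c::topological_space"
    and Z :: "'a \<Rightarrow> 'd::second_countable_topology"
    and h :: "'b \<times> 'd \<Rightarrow> 'e::topological_space"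
  assumes CI: "cond_indep_var M X Y Z"
    and X [measurable]: "X \<in> borel_measurable M" and Y [measurable]: "Y \<in> borel_measurable M"
    and Z [measurable]: "Z \<in> borel_measurable M" and h [measurable]: "h \<in> borel_measurable borel"
  shows "cond_indep_var M (\<lambda>\<omega>. h (X \<omega>, Z \<omega>)) Y Z"
proof -
  interpret F: sigma_finite_subalgebra M "vimage_algebra (space M) Z borel"
    by (rule sigma_finite_subalgebra_vimage_algebra[OF Z])
  let ?q = "\<lambda>B. real_cond_exp M (vimage_algebra (space M) Z borel) (\<lambda>\<omega>. indicator B (Y \<omega>))"
  have hXZ: "(\<lambda>\<omega>. h (X \<omega>, Z \<omega>)) \<in> borel_measurable M"
    by (rule measurable_compose[OF _ h]) simp
  have "(\<integral>\<omega>. indicator A (h (X \<omega>, Z \<omega>)) * indicator C (Z \<omega>) * indicator B (Y \<omega>) \<partial>M) =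
      (\<integral>\<omega>. indicator A (h (X \<omega>, Z \<omega>)) * indicator C (Z \<omega>) * ?q B \<omega> \<partial>M)"
    if A: "A \<in> sets borel" and B: "B \<in> sets borel" and C: "C \<in> sets borel" for A B C
  proof -
    \<comment> \<open>\<open>D\<close> collects the pairs \<open>(x, z)\<close> with
      \<open>h (x, z) \<in> A\<close> and \<open>z \<in> C\<close>; it is in general not a
      rectangle.\<close>
    define D where "D = (h -` A \<inter> snd -` C :: ('b \<times> 'd) set)"
    have "snd -` C \<inter> space (borel \<Otimes>\<^sub>M borel) \<in> sets (borel \<Otimes>\<^sub>M borel :: ('b \<times> 'd) measure)"
      using C by measurable
    then have "D \<in> sets borel"
      using measurable_sets[OF h A] unfolding D_def borel_prod by auto
    moreover have "integrable M (?q B)"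
      by (intro F.real_cond_exp_int integrable_indicator_comp Y B)
    moreover have "integrable M (\<lambda>\<omega>. indicator B (Y \<omega>) :: real)"
      by (intro integrable_indicator_comp Y B)
    ultimately have "(\<integral>\<omega>. indicator D (X \<omega>, Z \<omega>) * indicator B (Y \<omega>) \<partial>M) =
        (\<integral>\<omega>. indicator D (X \<omega>, Z \<omega>) * ?q B \<omega> \<partial>M)"
      using CI[unfolded cond_indep_var_iff_integral[OF X Y Z]] B
      by (intro integral_indicator_pair_eqI X Z) auto
    moreover have "indicator D (X \<omega>, Z \<omega>) = (indicator A (h (X \<omega>, Z \<omega>)) * indicator C (Z \<omega>) :: real)" for \<omega>
      by (simp add: D_def indicator_def)
    ultimately show ?thesis
      by simp
  qed
  then show ?thesis
    unfolding cond_indep_var_iff_integral[OF hXZ Y Z] by blast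
qed

text \<open>The preceding transformation is applied with \<open>f\<close> in one direction and with
  \<open>finv\<close> in the other, since \<open>X\<close> equals
  \<open>finv (f (X, Z), Z)\<close>.\<close>

lemma cond_indep_var_invertible_fst_iff:
  fixes X :: "'a \<Rightarrow> 'b::second_countable_topology" and Y :: "'a \<Rightarrow> 'c::topological_space"
    and Z :: "'a \<Rightarrow> 'd::second_countable_topology"
  assumes X [measurable]: "X \<in> borel_measurable M" and Y: "Y \<in> borel_measurable M"
    and Z [measurable]: "Z \<in> borel_measurable M" and f: "borel_invertible_fst f"
  shows "cond_indep_var M (\<lambda>\<omega>. f (X \<omega>, Z \<omega>)) Y Z \<longleftrightarrow> cond_indep_var M X Y Z"
proof
  obtain finv where f_meas: "f \<in> borel_measurable borel" and finv: "finv \<in> borel_measurable borel"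
    and inv: "\<And>x z. finv (f (x, z), z) = x"
    using f unfolding borel_invertible_fst_def by blast
  show "cond_indep_var M (\<lambda>\<omega>. f (X \<omega>, Z \<omega>)) Y Z" if "cond_indep_var M X Y Z"
    by (rule cond_indep_var_transform_fst[OF that X Y Z f_meas])
  have fXZ: "(\<lambda>\<omega>. f (X \<omega>, Z \<omega>)) \<in> borel_measurable M"
    by (rule measurable_compose[OF _ f_meas]) simp
  show "cond_indep_var M X Y Z" if "cond_indep_var M (\<lambda>\<omega>. f (X \<omega>, Z \<omega>)) Y Z"
    using cond_indep_var_transform_fst[OF that fXZ Y Z finv] by (simp add: inv)
qed

section \<open>From conditional to unconditional independence\<close>

text \<open>Independence of \<open>Y\<close> and \<open>Z\<close> makes
  \<open>P(Y \<in> B | Z)\<close> almost surely constant. The integral criterion then becomes the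
  factorization of \<open>Y\<close> against rectangles in \<open>(X, Z)\<close>, which is equivalent
  to factorization against all Borel sets of pairs.\<close>

lemma cond_indep_var_iff_indep_rv:
  fixes X :: "'a \<Rightarrow> 'b::second_countable_topology" and Y :: "'a \<Rightarrow> 'c::topological_space"
    and Z :: "'a \<Rightarrow> 'd::second_countable_topology"
  assumes X [measurable]: "X \<in> borel_measurable M" and Y [measurable]: "Y \<in> borel_measurable M"
    and Z [measurable]: "Z \<in> borel_measurable M" and indep: "indep_rv M Y Z"
  shows "cond_indep_var M X Y Z \<longleftrightarrow> indep_rv M Y (\<lambda>\<omega>. (X \<omega>, Z \<omega>))"
proof -
  interpret F: sigma_finite_subalgebra M "vimage_algebra (space M) Z borel"
    by (rule sigma_finite_subalgebra_vimage_algebra[OF Z])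
  let ?q = "\<lambda>B. real_cond_exp M (vimage_algebra (space M) Z borel) (\<lambda>\<omega>. indicator B (Y \<omega>))"
  let ?P = "\<lambda>B. prob (Y -` B \<inter> space M)"
  have XZ: "(\<lambda>\<omega>. (X \<omega>, Z \<omega>)) \<in> borel_measurable M"
    by simp
  have q: "AE \<omega> in M. ?q B \<omega> = ?P B" if B: "B \<in> sets borel" for B
  proof (rule F.real_cond_exp_charact)
    fix E assume "E \<in> sets (vimage_algebra (space M) Z borel)"
    then obtain C where C: "C \<in> sets borel" and E: "E = Z -` C \<inter> space M"
      by (auto simp: sets_vimage_algebra2)
    have "(LINT \<omega>:E|M. h \<omega>) = (\<integral>\<omega>. indicator C (Z \<omega>) * h \<omega> \<partial>M)" for h :: "'a \<Rightarrow> real"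
      unfolding set_lebesgue_integral_def E
      by (rule Bochner_Integration.integral_cong) (auto simp: indicator_def)
    then show "(LINT \<omega>:E|M. indicator B (Y \<omega>)) = (LINT \<omega>:E|M. ?P B)"
      using indep B C unfolding indep_rv_iff_integral[OF Y Z] by simp
  qed (simp_all add: integrable_indicator_comp B)
  have "(\<integral>\<omega>. indicator A (X \<omega>) * indicator C (Z \<omega>) * ?q B \<omega> \<partial>M) =
      (\<integral>\<omega>. indicator A (X \<omega>) * indicator C (Z \<omega>) * ?P B \<partial>M)"
    if [measurable]: "A \<in> sets borel" "B \<in> sets borel" "C \<in> sets borel" for A B C
    using q[OF that(2)] by (intro integral_cong_AE) auto
  then have CI_iff: "cond_indep_var M X Y Z \<longleftrightarrow>
      (\<forall>A \<in> sets borel. \<forall>B \<in> sets borel. \<forall>C \<in> sets borel.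
        (\<integral>\<omega>. indicator A (X \<omega>) * indicator C (Z \<omega>) * indicator B (Y \<omega>) \<partial>M) =
        (\<integral>\<omega>. indicator A (X \<omega>) * indicator C (Z \<omega>) * ?P B \<partial>M))"
    unfolding cond_indep_var_iff_integral[OF X Y Z] by simp
  show ?thesis
    unfolding CI_iff indep_rv_iff_integral[OF Y XZ]
  proof (intro iffI ballI)
    fix B :: "'c set" and D :: "('b \<times> 'd) set"
    assume eq: "\<forall>A \<in> sets borel. \<forall>B \<in> sets borel. \<forall>C \<in> sets borel.
        (\<integral>\<omega>. indicator A (X \<omega>) * indicator C (Z \<omega>) * indicator B (Y \<omega>) \<partial>M) =
        (\<integral>\<omega>. indicator A (X \<omega>) * indicator C (Z \<omega>) * ?P B \<partial>M)"
      and B: "B \<in> sets borel" and D: "D \<in> sets borel"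
    \<comment> \<open>The extension from rectangles is used with the weights
      \<open>indicator B (Y \<omega>)\<close> and the constant \<open>?P B\<close>.\<close>
    show "(\<integral>\<omega>. indicator D (X \<omega>, Z \<omega>) * indicator B (Y \<omega>) \<partial>M) =
        (\<integral>\<omega>. indicator D (X \<omega>, Z \<omega>) * ?P B \<partial>M)"
      using eq B by (intro integral_indicator_pair_eqI X Z D integrable_indicator_comp[OF Y B]) auto
  next
    fix A :: "'b set" and B :: "'c set" and C :: "'d set"
    assume eq: "\<forall>B \<in> sets borel. \<forall>D \<in> sets borel.
        (\<integral>\<omega>. indicator D (X \<omega>, Z \<omega>) * indicator B (Y \<omega>) \<partial>M) =
        (\<integral>\<omega>. indicator D (X \<omega>, Z \<omega>) * ?P B \<partial>M)"
      and A: "A \<in> sets borel" and B: "B \<in> sets borel" and C: "C \<in> sets borel"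
    have "A \<times> C \<in> sets borel"
      unfolding borel_prod[symmetric] using A C by (rule pair_measureI)
    then have "(\<integral>\<omega>. indicator (A \<times> C) (X \<omega>, Z \<omega>) * indicator B (Y \<omega>) \<partial>M) =
        (\<integral>\<omega>. indicator (A \<times> C) (X \<omega>, Z \<omega>) * ?P B \<partial>M)"
      using eq B by blast
    then show "(\<integral>\<omega>. indicator A (X \<omega>) * indicator C (Z \<omega>) * indicator B (Y \<omega>) \<partial>M) =
        (\<integral>\<omega>. indicator A (X \<omega>) * indicator C (Z \<omega>) * ?P B \<partial>M)"
      by (simp add: indicator_times)
  qed
qed

section \<open>The support of \<open>Z\<close> and constant conditional laws\<close>

text \<open>Every point outside the support has a null open neighbourhood, hence a null basic one. A
  countable basis has only countably many null members, so their union is null and covers the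
  complement.\<close>

lemma AE_rv_support:
  fixes Z :: "'a \<Rightarrow> 'd::second_countable_topology"
  assumes "Z \<in> borel_measurable M"
  shows "AE z in distr M borel Z. z \<in> rv_support M Z"
proof -
  obtain \<B> :: "'d set set" where \<B>: "countable \<B>" "topological_basis \<B>"
    using ex_countable_basis by blast
  define \<N> where "\<N> = {U \<in> \<B>. emeasure (distr M borel Z) U = 0}"
  have "countable \<N>"
    using \<B>(1) unfolding \<N>_def by simp
  moreover have "U \<in> null_sets (distr M borel Z)" if "U \<in> \<N>" for U
    using that topological_basis_open[OF \<B>(2)] by (auto simp: \<N>_def null_sets_def)
  ultimately have "\<Union>\<N> \<in> null_sets (distr M borel Z)"
    using null_sets_UN'[of \<N> id] by simp
  moreover have "- rv_support M Z \<subseteq> \<Union>\<N>"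
  proof
    fix z assume "z \<in> - rv_support M Z"
    then obtain U where U: "open U" "z \<in> U" "emeasure (distr M borel Z) U = 0"
      unfolding rv_support_def by (auto simp: not_gr_zero)
    obtain V where V: "V \<in> \<B>" "z \<in> V" "V \<subseteq> U"
      using topological_basisE[OF \<B>(2) U(1,2)] by blast
    then have "emeasure (distr M borel Z) V = 0"
      using U emeasure_mono[of V U "distr M borel Z"] by simp
    then show "z \<in> \<Union>\<N>"
      using V unfolding \<N>_def by blast
  qed
  ultimately show ?thesis
    by (intro AE_I'[of "\<Union>\<N>"]) auto
qed

text \<open>Integration against the law of \<open>Z\<close> sees the kernel only up to null sets,
  and the support carries this law. Replacing \<kappa> by its constant value on the support makes
  the joint law factor.\<close>

lemma indep_rv_if_cond_distr_const:
  fixes Z :: "'a \<Rightarrow> 'd::second_countable_topology"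
  assumes V [measurable]: "V \<in> borel_measurable M" and Z [measurable]: "Z \<in> borel_measurable M"
    and cond: "cond_distr M V Z \<kappa>" and const: "\<forall>z \<in> rv_support M Z. \<kappa> z = distr M borel V"
  shows "indep_rv M V Z"
  unfolding indep_rv_iff_integral[OF V Z]
proof (intro ballI)
  fix A :: "'b set" and B :: "'d set"
  assume A [measurable]: "A \<in> sets borel" and B [measurable]: "B \<in> sets borel"
  have "emeasure M {\<omega> \<in> space M. V \<omega> \<in> A \<and> Z \<omega> \<in> B} = (\<integral>\<^sup>+ z \<in> B. emeasure (\<kappa> z) A \<partial>distr M borel Z)"
    using cond A B unfolding cond_distr_def by blast
  also have "\<dots> = (\<integral>\<^sup>+ z \<in> B. emeasure (distr M borel V) A \<partial>distr M borel Z)"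
    using AE_rv_support[OF Z] const by (intro nn_integral_cong_AE) (auto elim!: eventually_mono)
  also have "\<dots> = emeasure (distr M borel V) A * emeasure (distr M borel Z) B"
    by (simp add: nn_integral_cmult_indicator)
  also have "\<dots> = ennreal (prob (V -` A \<inter> space M) * prob (Z -` B \<inter> space M))"
    by (simp add: emeasure_distr emeasure_eq_measure ennreal_mult)
  finally have "prob {\<omega> \<in> space M. V \<omega> \<in> A \<and> Z \<omega> \<in> B} = prob (V -` A \<inter> space M) * prob (Z -` B \<inter> space M)"
    by (simp add: emeasure_eq_measure)
  moreover have "(\<integral>\<omega>. indicator B (Z \<omega>) * indicator A (V \<omega>) \<partial>M) =
      (\<integral>\<omega>. indicator {\<omega> \<in> space M. V \<omega> \<in> A \<and> Z \<omega> \<in> B} \<omega> \<partial>M :: real)"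
    by (rule Bochner_Integration.integral_cong) (auto simp: indicator_def)
  ultimately show "(\<integral>\<omega>. indicator B (Z \<omega>) * indicator A (V \<omega>) \<partial>M) =
      (\<integral>\<omega>. indicator B (Z \<omega>) * prob (V -` A \<inter> space M) \<partial>M)"
    using integral_indicator_comp[OF Z B] by simp
qed

end

section \<open>Equivalence of the three independence statements\<close>

theorem lemma1:
  fixes M :: "'w measure"
    and X :: "'w \<Rightarrow> (real ^ 'dx)" and Y :: "'w \<Rightarrow> real ^ 'dy" and Z :: "'w \<Rightarrow> real ^ 'dz"
    and f :: "(real ^ 'dx) \<times> (real ^ 'dz) \<Rightarrow> (real ^ 'dx)"
    and g :: "(real ^ 'dy) \<times> (real ^ 'dz) \<Rightarrow> (real ^ 'dy)"
    and \<xi> :: "'w \<Rightarrow> (real ^ 'dx)" and \<eta> :: "'w \<Rightarrow> real ^ 'dy"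
    and \<kappa>\<xi> :: "real ^ 'dz \<Rightarrow> (real ^ 'dx) measure"
    and \<kappa>\<eta> :: "real ^ 'dz \<Rightarrow> (real ^ 'dy) measure"
  assumes "prob_space M"
    and "X \<in> borel_measurable M" and "Y \<in> borel_measurable M" and "Z \<in> borel_measurable M"
    and "borel_invertible_fst f" and "borel_invertible_fst g"
    and "\<xi> = (\<lambda>\<omega>. f (X \<omega>, Z \<omega>))" and "\<eta> = (\<lambda>\<omega>. g (Y \<omega>, Z \<omega>))"
    and "cond_distr M (\<lambda>\<omega>. f (X \<omega>, Z \<omega>)) Z \<kappa>\<xi>"
    and "\<forall>z \<in> rv_support M Z. \<kappa>\<xi> z = distr M borel \<xi>"
    and "cond_distr M (\<lambda>\<omega>. g (Y \<omega>, Z \<omega>)) Z \<kappa>\<eta>"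
    and "\<forall>z \<in> rv_support M Z. \<kappa>\<eta> z = distr M borel \<eta>"
  shows "indep_rv M \<xi> Z
    \<and> indep_rv M \<eta> Z
    \<and> (cond_indep_var M X Y Z \<longleftrightarrow>
         indep_rv M \<eta> (\<lambda>\<omega>. (\<xi> \<omega>, Z \<omega>)))
    \<and> (indep_rv M \<eta> (\<lambda>\<omega>. (\<xi> \<omega>, Z \<omega>)) \<longleftrightarrow>
         indep_rv M \<xi> (\<lambda>\<omega>. (\<eta> \<omega>, Z \<omega>)))"
proof -
  interpret prob_space M by fact
  note X [measurable] = assms(2) and Y [measurable] = assms(3) and Z [measurable] = assms(4)
  have f: "f \<in> borel_measurable borel" and g: "g \<in> borel_measurable borel"
    using assms(5,6) unfolding borel_invertible_fst_def by auto
  have \<xi>: "\<xi> \<in> borel_measurable M" and \<eta>: "\<eta> \<in> borel_measurable M"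
    unfolding assms(7,8) by (rule measurable_compose[OF _ f] measurable_compose[OF _ g]; simp)+
  have \<xi>_Z: "indep_rv M \<xi> Z"
    using indep_rv_if_cond_distr_const[OF \<xi> Z] assms(7,9,10) by simp
  have \<eta>_Z: "indep_rv M \<eta> Z"
    using indep_rv_if_cond_distr_const[OF \<eta> Z] assms(8,11,12) by simp
  have "cond_indep_var M X Y Z \<longleftrightarrow> cond_indep_var M \<xi> Y Z"
    unfolding assms(7) using cond_indep_var_invertible_fst_iff[OF X Y Z assms(5)] by simp
  \<comment> \<open>The change of variables acts on the first variable, so \<open>Y\<close> is moved
    there before it is replaced by \<eta>.\<close>
  also have "\<dots> \<longleftrightarrow> cond_indep_var M Y \<xi> Z"
    by (rule cond_indep_var_commute)
  also have "\<dots> \<longleftrightarrow> cond_indep_var M \<eta> \<xi> Z"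
    unfolding assms(8) using cond_indep_var_invertible_fst_iff[OF Y \<xi> Z assms(6)] by simp
  finally have "cond_indep_var M X Y Z \<longleftrightarrow> cond_indep_var M \<eta> \<xi> Z" .
  moreover have "cond_indep_var M \<eta> \<xi> Z \<longleftrightarrow> indep_rv M \<xi> (\<lambda>\<omega>. (\<eta> \<omega>, Z \<omega>))"
    by (rule cond_indep_var_iff_indep_rv[OF \<eta> \<xi> Z \<xi>_Z])
  \<comment> \<open>The variable known to be independent of \<open>Z\<close> must stand second; here
    it is \<eta>, whereas the previous equivalence used \<xi>.\<close>
  moreover have "cond_indep_var M \<eta> \<xi> Z \<longleftrightarrow> indep_rv M \<eta> (\<lambda>\<omega>. (\<xi> \<omega>, Z \<omega>))"
    unfolding cond_indep_var_commute[of \<eta>] by (rule cond_indep_var_iff_indep_rv[OF \<xi> \<eta> Z \<eta>_Z])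
  ultimately show ?thesis
    using \<xi>_Z \<eta>_Z by blast
qed

end
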